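(* Let $p\equiv 3\pmod 4$ be a prime. For an integer $k$, let $R(k,p)$ be the unique $r\in\{0,1,\dots,\frac{p-1}{2}\}$ such that $k\equiv r\pmod p$ or $k\equiv -r\pmod p$. Define $$N_p=\#\left\{(i,j):\ 1\le i<j\le \tfrac{p-1}{2}\ \text{and}\ R(i^2,p)>R(j^2,p)\right\}.$$ Then $N_p\equiv\left\lfloor\frac{p+1}{8}\right\rfloor\pmod 2$.
   Context: $\#S$ denotes the cardinality of a finite set $S$ and $\lfloor\cdot\rfloor$ the floor function. *)

theory Defs
  imports Complex_Main "HOL-Number_Theory.Number_Theory"
begin

definition R :: "int \<Rightarrow> nat \<Rightarrow> nat" where
  "R k p = (THE r. r \<in> {0..(p - 1) div 2} \<and>
     ([k = int r] (mod int p) \<or> [k = - int r] (mod int p)))"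

lemma R_ex1:
  fixes k :: int and p :: nat
  assumes "odd p"
  shows "\<exists>!r. r \<in> {0..(p - 1) div 2} \<and>
     ([k = int r] (mod int p) \<or> [k = - int r] (mod int p))"
proof -
  from assms obtain m where m: "p = 2 * m + 1" by (elim oddE)
  define s where "s = k mod int p"
  have s: "0 \<le> s" "s < int p" "[k = s] (mod int p)"
    using m by (simp_all add: s_def cong_def)
  have ex: "\<exists>r. r \<in> {0..(p - 1) div 2} \<and>
     ([k = int r] (mod int p) \<or> [k = - int r] (mod int p))"
  proof (cases "s \<le> int m")
    case True
    with s m show ?thesis by (intro exI[of _ "nat s"]) auto
  next
    case False
    have "[s = s - int p] (mod int p)" by (simp add: cong_def)
    with s have "[k = s - int p] (mod int p)" using cong_trans by blast
    with s m False show ?thesis by (intro exI[of _ "nat (int p - s)"]) auto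
  qed
  have uniq: "r = r'"
    if r: "r \<in> {0..(p - 1) div 2}" "r' \<in> {0..(p - 1) div 2}"
      and c: "[k = int r] (mod int p) \<or> [k = - int r] (mod int p)"
        "[k = int r'] (mod int p) \<or> [k = - int r'] (mod int p)" for r r'
  proof -
    have "[int r = int r'] (mod int p) \<or> [int r = - int r'] (mod int p)
        \<or> [- int r = int r'] (mod int p) \<or> [- int r = - int r'] (mod int p)"
      using c by (meson cong_sym cong_trans)
    then have "int p dvd int r - int r' \<or> int p dvd int r + int r'"
      by (auto simp: cong_iff_dvd_diff dvd_diff_commute)
         (metis add.commute dvd_minus_iff minus_add_distrib uminus_add_conv_diff)
    moreover have "\<bar>int r - int r'\<bar> < int p" "\<bar>int r + int r'\<bar> < int p"
      using r m by auto
    ultimately have "int r - int r' = 0 \<or> int r + int r' = 0"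
      using zdvd_not_zless dvd_imp_le_int by (metis abs_of_nat not_le)
    then show ?thesis by auto
  qed
  show ?thesis using ex uniq by blast
qed

definition N :: "nat \<Rightarrow> nat" where
  "N p = card {(i::nat, j::nat). 1 \<le> i \<and> i < j \<and> j \<le> (p - 1) div 2 \<and>
     R (int i ^ 2) p > R (int j ^ 2) p}"

end

theory Submission
  imports Defs
begin

text \<open>
  Since \<open>-1\<close> is a non-residue, squaring permutes the group of nonzero residues modulo \<open>p\<close> up to
  sign, which is cyclic of odd order \<open>n = (p - 1) / 2\<close>, and \<open>R\<close> identifies this group with
  \<open>{1..n}\<close>. The parity of the number of inversions is multiplicative under composition of bijections
  between finite linearly ordered sets, hence invariant under conjugation. A primitive root conjugates
  squaring to doubling on \<open>{0..<n}\<close> modulo \<open>n\<close>, whose inversions can be counted directly: with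
  \<open>n = 2 m + 1\<close> there are \<open>m (m + 1) / 2\<close> of them.
\<close>

definition inversions :: "('a::linorder \<Rightarrow> 'b::linorder) \<Rightarrow> 'a set \<Rightarrow> ('a \<times> 'a) set" where
  "inversions f A = {(i, j). i \<in> A \<and> j \<in> A \<and> i < j \<and> f i > f j}"

text \<open>For a permutation of a finite \<open>A\<close> this is its usual sign. Leaving the
  codomain free lets it apply also to bijections between different ordered sets, such as exponents
  and residues below.\<close>

definition inversion_sign :: "('a::linorder \<Rightarrow> 'b::linorder) \<Rightarrow> 'a set \<Rightarrow> int" where
  "inversion_sign f A = (- 1) ^ card (inversions f A)"

text \<open>A product over ordered pairs can be split factorwise and reindexed, unlike the
  cardinality in the exponent.\<close>

lemma inversion_sign_eq_prod:
  assumes "finite A"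
  shows "inversion_sign f A =
    (\<Prod>(i, j) \<in> {(i, j). i \<in> A \<and> j \<in> A \<and> i < j}. if f i > f j then - 1 else 1)"
proof -
  let ?P = "{(i, j). i \<in> A \<and> j \<in> A \<and> i < j}"
  have fin: "finite ?P"
    by (rule finite_subset[of _ "A \<times> A"]) (use assms in auto)
  have "(\<Prod>(i, j) \<in> ?P. if f i > f j then - 1 else (1::int)) =
      (\<Prod>x \<in> ?P. if x \<in> inversions f A then - 1 else 1)"
    by (rule prod.cong) (auto simp: inversions_def split: if_splits)
  also have "\<dots> = (\<Prod>x \<in> ?P \<inter> inversions f A. - 1)"
    using fin by (rule prod.inter_restrict[symmetric])
  also have "?P \<inter> inversions f A = inversions f A"
    by (auto simp: inversions_def)
  finally show ?thesis
    by (simp add: inversion_sign_def)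
qed

text \<open>Sorting the image of a pair under \<open>f\<close> matches the increasing pairs of
  \<open>A\<close> with those of \<open>B\<close>. A pair is inverted by \<open>g \<circ> f\<close>
  iff exactly one of two things happens: \<open>f\<close> inverts it, or \<open>g\<close> inverts
  its sorted image.\<close>

lemma inversion_sign_comp:
  fixes f :: "'a::linorder \<Rightarrow> 'b::linorder" and g :: "'b \<Rightarrow> 'c::linorder"
  assumes "finite A" and f: "bij_betw f A B" and g: "inj_on g B"
  shows "inversion_sign (g \<circ> f) A = inversion_sign f A * inversion_sign g B"
proof -
  let ?P = "{(i, j). i \<in> A \<and> j \<in> A \<and> i < j}"
  let ?Q = "{(i, j). i \<in> B \<and> j \<in> B \<and> i < j}"
  let ?s = "\<lambda>(i, j). (min (f i) (f j), max (f i) (f j))"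
  let ?h = "\<lambda>(i, j). if g i > g j then - 1 else (1::int)"
  let ?f' = "inv_into A f"
  have finB: "finite B" using assms bij_betw_finite by blast
  have injf: "inj_on f A" and imf: "f ` A = B"
    using f by (auto simp: bij_betw_def)
  have f': "?f' y \<in> A" "f (?f' y) = y" if "y \<in> B" for y
    using that imf by (auto simp: inv_into_into f_inv_into_f)
  have f'f: "?f' (f x) = x" if "x \<in> A" for x
    using that injf by simp
  have fB: "f x \<in> B" if "x \<in> A" for x using that imf by auto
  have f_eq: "f i = f j \<longleftrightarrow> i = j" if "i \<in> A" "j \<in> A" for i j
    using that injf by (auto dest: inj_onD)
  have g_eq: "g i = g j \<longleftrightarrow> i = j" if "i \<in> B" "j \<in> B" for i j
    using that g by (auto dest: inj_onD)
  have f'_eq: "?f' i = ?f' j \<longleftrightarrow> i = j" if "i \<in> B" "j \<in> B" for i j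
    using that f' by metis
  \<comment> \<open>The inverse of the sorted image map pulls both entries back along
    \<open>?f'\<close> and sorts again.\<close>
  have reindex: "(\<Prod>x \<in> ?P. ?h (?s x)) = (\<Prod>x \<in> ?Q. ?h x)"
    by (rule prod.reindex_bij_witness[where j = ?s and
          i = "\<lambda>(x, y). (min (?f' x) (?f' y), max (?f' x) (?f' y))"])
       (auto simp: min_def max_def f' f'f fB f_eq f'_eq not_le less_le split: if_splits)
  have "inversion_sign (g \<circ> f) A =
      (\<Prod>x \<in> ?P. (case x of (i, j) \<Rightarrow> if f i > f j then - 1 else 1) * ?h (?s x))"
    unfolding inversion_sign_eq_prod[OF \<open>finite A\<close>]
  proof (rule prod.cong, goal_cases)
    case (2 x)
    obtain i j where x: "x = (i, j)" "i \<in> A" "j \<in> A" "i < j" using 2 by auto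
    then have "f i \<noteq> f j" "g (f i) \<noteq> g (f j)" by (auto simp: f_eq g_eq fB)
    then show ?case using x by (auto simp: min_def max_def)
  qed simp
  then show ?thesis
    by (simp add: prod.distrib reindex inversion_sign_eq_prod \<open>finite A\<close> finB)
qed

text \<open>On \<open>A\<close> the maps \<open>s \<circ> h\<close> and \<open>h \<circ> d\<close>
  agree, so multiplicativity equates their signs, and the sign of \<open>h\<close>, being 1 or -1,
  cancels.\<close>

lemma inversion_sign_conj:
  fixes h :: "'a::linorder \<Rightarrow> 'b::linorder"
  assumes "finite A" and h: "bij_betw h A B" and d: "bij_betw d A A"
    and comm: "\<And>x. x \<in> A \<Longrightarrow> s (h x) = h (d x)"
  shows "inversion_sign s B = inversion_sign d A"
proof -
  have "bij_betw (h \<circ> d) A B" using d h by (rule bij_betw_trans)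
  then have "inj_on (s \<circ> h) A"
    using comm by (auto simp: bij_betw_def inj_on_def)
  then have s: "inj_on s B"
    using h by (auto simp: bij_betw_def dest: inj_on_imageI)
  have "inversions (s \<circ> h) A = inversions (h \<circ> d) A"
    using comm by (auto simp: inversions_def)
  then have "inversion_sign (s \<circ> h) A = inversion_sign (h \<circ> d) A"
    by (simp add: inversion_sign_def)
  then have "inversion_sign h A * inversion_sign s B = inversion_sign d A * inversion_sign h A"
    using h d s \<open>finite A\<close> by (simp add: inversion_sign_comp bij_betw_imp_inj_on)
  then show ?thesis by (simp add: inversion_sign_def)
qed

lemma double_mod_odd:
  assumes "k < 2 * m + (1::nat)"
  shows "2 * k mod (2 * m + 1) = (if k \<le> m then 2 * k else 2 * k - (2 * m + 1))"
  using assms by (auto simp: mod_if)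

lemma bij_betw_double_mod_odd:
  "bij_betw (\<lambda>k. 2 * k mod (2 * m + 1)) {..<2 * m + 1} {..<2 * m + (1::nat)}"
proof -
  have "inj_on (\<lambda>k. 2 * k mod (2 * m + 1)) {..<2 * m + (1::nat)}"
  proof (rule inj_onI)
    fix x y :: nat
    assume "x \<in> {..<2 * m + 1}" "y \<in> {..<2 * m + 1}"
      "2 * x mod (2 * m + 1) = 2 * y mod (2 * m + 1)"
    then show "x = y"
      by (simp only: lessThan_iff double_mod_odd split: if_splits) presburger+
  qed
  moreover have "(\<lambda>k. 2 * k mod (2 * m + 1)) ` {..<2 * m + 1} \<subseteq> {..<2 * m + (1::nat)}"
    by auto
  ultimately show ?thesis
    by (simp add: bij_betw_def endo_inj_surj)
qed

text \<open>Doubling is increasing on \<open>{..m}\<close>, with \<open>a\<close> going to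
  \<open>2 * a\<close>, and on the rest, with \<open>m + 1 + c\<close> going to
  \<open>2 * c + 1\<close>. Inversions therefore pair \<open>a\<close> from the first half with
  \<open>m + 1 + c\<close> from the second, exactly when \<open>c < a\<close>.\<close>

lemma card_inversions_double_mod_odd:
  "card (inversions (\<lambda>k. 2 * k mod (2 * m + 1)) {..<2 * m + (1::nat)}) = m * (m + 1) div 2"
proof -
  let ?d = "\<lambda>k. 2 * k mod (2 * m + (1::nat))"
  let ?S = "Sigma {..m} (\<lambda>a. {..<a})"
  let ?e = "\<lambda>(a, c). (a, m + 1 + c)"
  have "inversions ?d {..<2 * m + 1} = ?e ` ?S"
  proof (intro Set.set_eqI iffI)
    fix x assume "x \<in> inversions ?d {..<2 * m + 1}"
    then obtain a b where ab: "x = (a, b)" "a < 2 * m + 1" "b < 2 * m + 1" "a < b" "?d a > ?d b"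
      by (auto simp: inversions_def)
    have "a \<le> m \<and> b > m \<and> 2 * b < 2 * a + (2 * m + 1)"
      using ab(4,5) unfolding double_mod_odd[OF ab(2)] double_mod_odd[OF ab(3)]
      by (auto split: if_splits)
    then have "(a, b - (m + 1)) \<in> ?S" "x = ?e (a, b - (m + 1))"
      using ab(1) by auto
    then show "x \<in> ?e ` ?S" by blast
  next
    fix x assume "x \<in> ?e ` ?S"
    then obtain a c where ac: "x = (a, m + 1 + c)" "a \<le> m" "c < a" by auto
    then have b: "a < 2 * m + 1" "m + 1 + c < 2 * m + 1" by auto
    have "?d a > ?d (m + 1 + c)"
      unfolding double_mod_odd[OF b(1)] double_mod_odd[OF b(2)] using ac by auto
    then show "x \<in> inversions ?d {..<2 * m + 1}"
      using ac b by (auto simp: inversions_def)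
  qed
  moreover have "inj_on ?e ?S" by (auto simp: inj_on_def)
  ultimately have "card (inversions ?d {..<2 * m + 1}) = (\<Sum>a\<le>m. a)"
    by (simp add: card_image)
  also have "\<dots> = m * (m + 1) div 2"
    using gauss_sum_nat[of m] by (simp add: atMost_atLeast0)
  finally show ?thesis .
qed

lemma R_props:
  assumes "odd p"
  shows "R k p \<le> (p - 1) div 2"
    and "[k = int (R k p)] (mod int p) \<or> [k = - int (R k p)] (mod int p)"
  using theI'[OF R_ex1[OF assms, of k]] unfolding R_def by auto

lemma R_square_cong:
  assumes "odd p"
  shows "[int (R k p) ^ 2 = k ^ 2] (mod int p)"
  using R_props(2)[OF assms, of k] cong_pow[of k "int (R k p)" "int p" 2]
    cong_pow[of k "- int (R k p)" "int p" 2]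
  by (auto intro: cong_sym)

text \<open>By primality, equal squares mean \<open>k\<close> is congruent to \<open>l\<close> or
  \<open>- l\<close>, which is precisely the ambiguity that \<open>R\<close> removes. Squares thus
  avoid case splits on signs.\<close>

lemma R_eq_iff:
  assumes "prime p" and "odd p"
  shows "R k p = R l p \<longleftrightarrow> [k ^ 2 = l ^ 2] (mod int p)"
proof
  assume "R k p = R l p"
  then show "[k ^ 2 = l ^ 2] (mod int p)"
    using R_square_cong[OF \<open>odd p\<close>] cong_sym cong_trans by metis
next
  assume "[k ^ 2 = l ^ 2] (mod int p)"
  then have "int p dvd (k - l) * (k + l)"
    by (simp add: cong_iff_dvd_diff power2_eq_square algebra_simps)
  then have "int p dvd k - l \<or> int p dvd k + l"
    using \<open>prime p\<close> by (simp add: prime_dvd_mult_iff)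
  then have "[k = l] (mod int p) \<or> [k = - l] (mod int p)"
    by (simp add: cong_iff_dvd_diff)
  moreover have "[l = int (R l p)] (mod int p) \<or> [l = - int (R l p)] (mod int p)"
    by (rule R_props(2)[OF \<open>odd p\<close>])
  ultimately have "[k = int (R l p)] (mod int p) \<or> [k = - int (R l p)] (mod int p)"
    using cong_trans cong_minus_minus_iff minus_minus by metis
  then show "R k p = R l p"
    using R_ex1[OF \<open>odd p\<close>, of k] R_props[OF \<open>odd p\<close>] by (metis atLeastAtMost_iff le0)
qed

theorem theorem1p5:
  fixes p :: nat
  assumes "prime p" and "[p = 3] (mod 4)"
  shows "[int (N p) = \<lfloor>(real p + 1) / 8\<rfloor>] (mod 2)"
proof -
  define m where "m = p div 4"
  \<comment> \<open>The residue of \<open>p\<close> modulo 4 makes \<open>n\<close> odd, which is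
    what turns doubling modulo \<open>n\<close> into a permutation.\<close>
  define n where "n = 2 * m + 1"
  have p: "p = 4 * m + 3" using assms(2) unfolding m_def cong_def by presburger
  then have odd: "odd p" and half: "(p - 1) div 2 = n" and p1: "p - 1 = 2 * n"
    by (auto simp: n_def)
  obtain g where g: "residue_primroot p g"
    using prime_primitive_root_exists[of p] \<open>prime p\<close> prime_gt_1_nat by blast
  then have g_cop: "coprime p g" and g_ord: "ord p g = 2 * n"
    using \<open>prime p\<close> p1 by (auto simp: residue_primroot_def totient_prime)
  define h where "h k = R (int (g ^ k)) p" for k
  \<comment> \<open>Comparing squares doubles the exponents of \<open>g\<close>; since
    \<open>g\<close> has order \<open>2 * n\<close>, the factor 2 cancels and leaves exponents
    modulo \<open>n\<close>.\<close>
  have h_eq: "h k = h l \<longleftrightarrow> [k = l] (mod n)" for k l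
  proof -
    have "h k = h l \<longleftrightarrow> [g ^ (k * 2) = g ^ (l * 2)] (mod p)"
      unfolding h_def R_eq_iff[OF \<open>prime p\<close> odd]
      by (simp add: power_mult flip: cong_int_iff)
    also have "\<dots> \<longleftrightarrow> [k * 2 = l * 2] (mod (n * 2))"
      using order_divides_expdiff[OF g_cop] g_ord by (simp add: mult.commute)
    also have "\<dots> \<longleftrightarrow> [k = l] (mod n)"
      by (simp add: cong_def mod_mult_mult2)
    finally show ?thesis .
  qed
  have h_pos: "h k \<noteq> 0" for k
  proof
    assume "h k = 0"
    then have "int p dvd int (g ^ k) ^ 2"
      using R_square_cong[OF odd, of "int (g ^ k)"]
      by (simp add: h_def cong_iff_dvd_diff)
    then have "p dvd g"
      using \<open>prime p\<close> by (metis int_dvd_int_iff of_nat_power prime_dvd_power)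
    then show False
      using g_cop \<open>prime p\<close> by (metis coprime_absorb_left not_prime_unit)
  qed
  have "inj_on h {..<n}"
    by (auto intro!: inj_onI simp: h_eq cong_def)
  \<comment> \<open>Both sets have \<open>n\<close> elements, so injectivity and this inclusion
    suffice for a bijection.\<close>
  moreover have "h ` {..<n} \<subseteq> {1..n}"
    using h_pos R_props(1)[OF odd] half by (auto simp: h_def Suc_le_eq)
  ultimately have bij: "bij_betw h {..<n} {1..n}"
    by (simp add: bij_betw_def card_image card_subset_eq)
  let ?s = "\<lambda>i. R (int i ^ 2) p"
  \<comment> \<open>Replacing \<open>g ^ k\<close> by its representative \<open>h k\<close> changes
    at most the sign modulo \<open>p\<close>, which squaring forgets.\<close>
  have comm: "?s (h k) = h (2 * k mod n)" for k
  proof -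
    have "?s (h k) = h (2 * k)"
      using cong_pow[OF R_square_cong[OF odd, of "int (g ^ k)"], of 2]
      unfolding h_def R_eq_iff[OF \<open>prime p\<close> odd]
      by (simp add: mult.commute flip: power_mult)
    also have "\<dots> = h (2 * k mod n)" by (simp add: h_eq cong_def)
    finally show ?thesis .
  qed
  have "inversion_sign ?s {1..n} = inversion_sign (\<lambda>k. 2 * k mod n) {..<n}"
    using bij bij_betw_double_mod_odd[of m] comm
    by (intro inversion_sign_conj[where h = h]) (auto simp: n_def)
  moreover have "N p = card (inversions ?s {1..n})"
    unfolding N_def half inversions_def by (rule arg_cong[where f = card]) auto
  ultimately have "(- 1 :: int) ^ N p = (- 1) ^ (m * (m + 1) div 2)"
    using card_inversions_double_mod_odd[of m] by (simp add: inversion_sign_def n_def)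
  then have "even (N p) \<longleftrightarrow> even (m * (m + 1) div 2)"
    by (auto simp: minus_one_power_iff split: if_splits)
  \<comment> \<open>One of \<open>m\<close> and \<open>m + 1\<close> is odd and does not affect
    parity; half of the other one is \<open>(m + 1) div 2\<close>.\<close>
  also have "\<dots> \<longleftrightarrow> even ((m + 1) div 2)"
  proof (cases "even m")
    case True
    then obtain k where "m = 2 * k" by (elim evenE)
    then have "m * (m + 1) div 2 = k * (2 * k + 1)" "(m + 1) div 2 = k" by auto
    then show ?thesis by simp
  next
    case False
    then obtain k where "m = 2 * k + 1" by (elim oddE)
    then have "m * (m + 1) = 2 * ((2 * k + 1) * (k + 1))" "(m + 1) div 2 = k + 1" by auto
    then show ?thesis by simp
  qed
  finally have "even (N p) \<longleftrightarrow> even ((m + 1) div 2)" .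
  moreover have "\<lfloor>(real p + 1) / 8\<rfloor> = int ((m + 1) div 2)"
  proof -
    have "(real p + 1) / 8 = real (m + 1) / real 2" by (simp add: p)
    then show ?thesis by (simp only: floor_divide_of_nat_eq)
  qed
  ultimately show ?thesis
    by (simp add: cong_def) presburger
qed

end
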